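(* Let $k\in(0,1)$. For $a,b\in(-K,K]$, let $c\in(-K,K]$ be the unique number such that $a+b$ is congruent to $c$ modulo $2K$, and define $C_a\circ C_b=C_c$. Then the set $\{C_a: a\in(-K,K]\}$ is a commutative group under this operation, its identity element is $C_0$, the unit circle $T$, and the inverse of $C_a$ is $C_{-a}$.
   Context: Elliptic functions with modulus $k$: $g(\theta)=g(\theta;k)=\int_0^\theta \frac{dt}{\sqrt{1-k^2\sin^2 t}}$ for $\theta\in\mathbb R$, $K=g(\pi/2)$, $\mathrm{am}=g^{-1}:\mathbb R\to\mathbb R$, $\mathrm{sn}\,u=\sin(\mathrm{am}\,u)$, $\mathrm{cn}\,u=\cos(\mathrm{am}\,u)$, $\mathrm{dn}\,u=\sqrt{1-k^2\,\mathrm{sn}^2u}$. For $a\in(-K,K]$, $C_a$ is the oriented circle in the plane with center $\left(\frac{\mathrm{dn}\,a-1}{\mathrm{dn}\,a+1},0\right)$ and radius $\frac{2\,\mathrm{cn}\,a}{1+\mathrm{dn}\,a}$, positively oriented (counterclockwise) if $0<a<K$ and negatively oriented (clockwise) if $-K<a<0$. $C_0$ is the unit circle $T$ (no orientation attached), and $C_K$ is the point circle at $L=\frac{k'-1}{k'+1}$, $k'=\sqrt{1-k^2}$. Thus distinct $a\in(-K,K]$ give distinct oriented circles. Indices are read modulo $2K$, so $C_{-K}$ means $C_K$. *)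

theory Defs
  imports
    "HOL-Analysis.Analysis"
    "HOL-Library.Real_Mod"
    "HOL-Algebra.Group"
begin

(* The interval integral is signed, so ell_g is also correct for negative arguments. *)
definition ell_g :: "real \<Rightarrow> real \<Rightarrow> real" where
  "ell_g k \<theta> = (LBINT t=0..ereal \<theta>. 1 / sqrt (1 - k\<^sup>2 * (sin t)\<^sup>2))"

definition ell_K :: "real \<Rightarrow> real" where
  "ell_K k = ell_g k (pi / 2)"

definition am :: "real \<Rightarrow> real \<Rightarrow> real" where
  "am k = inv_into UNIV (ell_g k)"

definition sn :: "real \<Rightarrow> real \<Rightarrow> real" where
  "sn k u = sin (am k u)"

definition cn :: "real \<Rightarrow> real \<Rightarrow> real" where
  "cn k u = cos (am k u)"

definition dn :: "real \<Rightarrow> real \<Rightarrow> real" where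
  "dn k u = sqrt (1 - k\<^sup>2 * (sn k u)\<^sup>2)"

datatype orientation = Counterclockwise | Clockwise | Unoriented

(* An oriented circle is its set of points together with its orientation. The plane is
   real \<times> real with its Euclidean metric; a sphere of radius 0 is a point circle. *)
type_synonym oriented_circle = "(real \<times> real) set \<times> orientation"

definition unit_circle :: oriented_circle where
  "unit_circle = (sphere (0, 0) 1, Unoriented)"

(* Meaningful for -K < a \<le> K only. At a = K one has cn = 0 and dn = sqrt (1 - k\<^sup>2), so the
   formula yields the point circle at L = (k' - 1) / (k' + 1), with k' = sqrt (1 - k\<^sup>2). *)
definition base_circle :: "real \<Rightarrow> real \<Rightarrow> oriented_circle" where
  "base_circle k a =
     (sphere ((dn k a - 1) / (dn k a + 1), 0) (2 * cn k a / (1 + dn k a)),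
      if 0 < a \<and> a < ell_K k then Counterclockwise
      else if - ell_K k < a \<and> a < 0 then Clockwise
      else Unoriented)"

definition reduced :: "real \<Rightarrow> real \<Rightarrow> real" where
  "reduced k u = (THE c. c \<in> {- ell_K k<..ell_K k} \<and> [u = c] (rmod 2 * ell_K k))"

(* Indices are read modulo 2K; in particular the circle with index -K is the one with index K. *)
definition circ :: "real \<Rightarrow> real \<Rightarrow> oriented_circle" where
  "circ k u = base_circle k (reduced k u)"

definition circ_index :: "real \<Rightarrow> oriented_circle \<Rightarrow> real" where
  "circ_index k X = (THE a. a \<in> {- ell_K k<..ell_K k} \<and> circ k a = X)"

definition circ_op :: "real \<Rightarrow> oriented_circle \<Rightarrow> oriented_circle \<Rightarrow> oriented_circle" where
  "circ_op k X Y = circ k (reduced k (circ_index k X + circ_index k Y))"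

definition circle_group :: "real \<Rightarrow> oriented_circle monoid" where
  "circle_group k =
     \<lparr>carrier = circ k ` {- ell_K k<..ell_K k}, mult = circ_op k, one = circ k 0\<rparr>"

end

theory Submission
  imports Defs
begin

text \<open>
  The integrand defining the elliptic integral is even and at least 1, so \<open>ell_g k\<close> is an
  odd increasing bijection of the real line, and the amplitude maps the index interval
  monotonically and oddly onto \<open>{-pi/2<..pi/2}\<close>. A circle determines its center and
  radius, hence \<open>dn\<close> and \<open>cn\<close>, hence \<open>cos (am k a)\<close>, hence the index up to sign;
  the orientation fixes the sign. So the circles are in bijection with the reals modulo \<open>2K\<close>,
  and the operation is the transported addition.
\<close>

section \<open>Circles centered on the axis; representatives modulo a period\<close>

text \<open>The two points where each sphere meets the axis lie on the other one, and the resulting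
  distance equations leave no freedom. Nonnegative radii matter: spheres of negative radius are all
  empty.\<close>

lemma sphere_on_axis_eq_iff:
  fixes c d r s :: real
  assumes "0 \<le> r" "0 \<le> s"
  shows "sphere (c, 0::real) r = sphere (d, 0) s \<longleftrightarrow> c = d \<and> r = s"
proof
  assume eq: "sphere (c, 0::real) r = sphere (d, 0) s"
  have mem: "(x, 0::real) \<in> sphere (y, 0) t \<longleftrightarrow> \<bar>y - x\<bar> = t" for x y t :: real
    by (simp add: dist_Pair_Pair dist_real_def)
  have "\<bar>d - (c + r)\<bar> = s" "\<bar>d - (c - r)\<bar> = s"
    using assms unfolding mem[symmetric] eq[symmetric] unfolding mem by simp_all
  moreover have "\<bar>c - (d + s)\<bar> = r" "\<bar>c - (d - s)\<bar> = r"
    using assms unfolding mem[symmetric] eq unfolding mem by simp_all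
  ultimately show "c = d \<and> r = s"
    using assms by linarith
qed simp

lemma ex1_rcong_interval:
  assumes "0 < M"
  shows "\<exists>!c. c \<in> {- M<..M} \<and> [u = c] (rmod 2 * M)"
proof (rule ex_ex1I)
  \<comment> \<open>\<open>rmod\<close> lands in \<open>{0..<2 * M}\<close>; subtracting it from
    \<open>M\<close> flips this so that the right end is the closed one.\<close>
  let ?c = "M - (M - u) rmod (2 * M)"
  have "[M - (M - u) = ?c] (rmod 2 * M)"
    by (simp only: rcong_diff_left_cancel rcong_rmod_right_iff rcong_refl)
  moreover have "?c \<in> {- M<..M}"
    using assms rmod_nonneg[of "2 * M" "M - u"] rmod_less[of "2 * M" "M - u"] by auto
  ultimately show "\<exists>c. c \<in> {- M<..M} \<and> [u = c] (rmod 2 * M)"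
    by (intro exI[of _ ?c]) simp
next
  fix c d
  assume c: "c \<in> {- M<..M} \<and> [u = c] (rmod 2 * M)" and d: "d \<in> {- M<..M} \<and> [u = d] (rmod 2 * M)"
  then have "[c = d] (rmod 2 * M)"
    using rcong_sym rcong_trans by blast
  then show "c = d"
    using c d by (intro rcong_imp_eq[of c d "2 * M"]) auto
qed

section \<open>The elliptic integral as an odd increasing bijection\<close>

context
  fixes k :: real
  assumes modulus: "k\<^sup>2 < 1"
begin

lemma delta_bounds: "0 < 1 - k\<^sup>2 * (sin t)\<^sup>2" "1 - k\<^sup>2 * (sin t)\<^sup>2 \<le> 1"
proof -
  have "k\<^sup>2 * (sin t)\<^sup>2 \<le> k\<^sup>2 * 1"
    by (intro mult_left_mono) (simp_all add: abs_square_le_1)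
  with modulus show "0 < 1 - k\<^sup>2 * (sin t)\<^sup>2"
    by simp
qed simp

lemma ell_g_has_real_derivative:
  "(ell_g k has_real_derivative 1 / sqrt (1 - k\<^sup>2 * (sin \<theta>)\<^sup>2)) (at \<theta>)"
proof -
  let ?f = "\<lambda>t. 1 / sqrt (1 - k\<^sup>2 * (sin t)\<^sup>2)"
  \<comment> \<open>A symmetric interval containing 0, with \<theta> in its interior for either
    sign, so the derivative within it is the full derivative.\<close>
  let ?b = "\<bar>\<theta>\<bar> + 1"
  have "continuous_on {- ?b..?b} ?f"
    using delta_bounds(1) by (intro continuous_intros) (metis less_irrefl real_sqrt_eq_0_iff)
  then have "((\<lambda>u. LBINT t=ereal 0..ereal u. ?f t) has_vector_derivative ?f \<theta>) (at \<theta> within {- ?b..?b})"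
    by (rule interval_integral_FTC2[rotated 2]) auto
  then have "(ell_g k has_vector_derivative ?f \<theta>) (at \<theta> within {- ?b..?b})"
    by (simp add: ell_g_def[abs_def] zero_ereal_def)
  then show ?thesis
    by (simp add: has_real_derivative_iff_has_vector_derivative at_within_Icc_at)
qed

lemma ell_g_zero [simp]: "ell_g k 0 = 0"
  by (simp add: ell_g_def zero_ereal_def[symmetric])

text \<open>The integrand is even, so the sum of both sides' integrals has derivative 0 and keeps
  its value at 0.\<close>

lemma ell_g_minus [simp]: "ell_g k (- \<theta>) = - ell_g k \<theta>"
proof -
  have "((\<lambda>x. ell_g k (- x) + ell_g k x) has_real_derivative 0) (at x)" for x
    by (rule derivative_eq_intros DERIV_chain2[OF ell_g_has_real_derivative]
        ell_g_has_real_derivative refl)+ simp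
  from DERIV_isconst_all[of "\<lambda>x. ell_g k (- x) + ell_g k x" \<theta> 0, OF allI[OF this]] show ?thesis
    by simp
qed

text \<open>The derivative is at least 1. This one bound yields both strict monotonicity and
  unboundedness in both directions.\<close>

lemma ell_g_increment: "x \<le> y \<Longrightarrow> y - x \<le> ell_g k y - ell_g k x"
proof -
  assume "x \<le> y"
  have "\<exists>d. ((\<lambda>t. ell_g k t - t) has_real_derivative d) (at t) \<and> 0 \<le> d" for t
  proof (intro exI conjI)
    show "((\<lambda>t. ell_g k t - t) has_real_derivative 1 / sqrt (1 - k\<^sup>2 * (sin t)\<^sup>2) - 1) (at t)"
      by (intro derivative_intros ell_g_has_real_derivative)
    show "0 \<le> 1 / sqrt (1 - k\<^sup>2 * (sin t)\<^sup>2) - 1"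
      using delta_bounds[of t] by (simp add: field_simps)
  qed
  then have "ell_g k x - x \<le> ell_g k y - y"
    using \<open>x \<le> y\<close> by (intro DERIV_nonneg_imp_nondecreasing[of x y "\<lambda>t. ell_g k t - t"]) auto
  then show ?thesis by simp
qed

lemma strict_mono_ell_g: "strict_mono (ell_g k)"
proof (rule strict_monoI)
  fix x y :: real
  assume "x < y"
  then show "ell_g k x < ell_g k y"
    using ell_g_increment[of x y] by simp
qed

lemma bij_ell_g: "bij (ell_g k)"
proof -
  have "\<exists>x. ell_g k x = y" for y
  proof -
    have "ell_g k (- \<bar>y\<bar>) \<le> y" "y \<le> ell_g k \<bar>y\<bar>"
      using ell_g_increment[of "-\<bar>y\<bar>" 0] ell_g_increment[of 0 "\<bar>y\<bar>"] by simp_all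
    then have "\<exists>x\<ge>-\<bar>y\<bar>. x \<le> \<bar>y\<bar> \<and> ell_g k x = y"
      using DERIV_isCont[OF ell_g_has_real_derivative] by (intro IVT) simp_all
    then show ?thesis by blast
  qed
  then have "surj (ell_g k)"
    unfolding surj_def by metis
  with strict_mono_imp_inj_on[OF strict_mono_ell_g] show ?thesis
    by (rule bijI)
qed

lemma ell_K_pos: "0 < ell_K k"
  using strict_mono_less[OF strict_mono_ell_g, of 0 "pi / 2"] by (simp add: ell_K_def)

section \<open>The amplitude\<close>

lemma am_ell_g [simp]: "am k (ell_g k \<theta>) = \<theta>"
  using bij_ell_g by (simp add: am_def bij_is_inj)

lemma ell_g_am [simp]: "ell_g k (am k u) = u"
  using bij_ell_g by (simp add: am_def bij_is_surj surj_f_inv_f)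

lemma am_less_iff: "am k u < am k v \<longleftrightarrow> u < v"
  using strict_mono_less[OF strict_mono_ell_g] by (metis ell_g_am)

lemma am_le_iff: "am k u \<le> am k v \<longleftrightarrow> u \<le> v"
  using am_less_iff by (meson not_le)

lemma am_minus [simp]: "am k (- u) = - am k u"
  by (metis am_ell_g ell_g_am ell_g_minus)

lemma am_zero [simp]: "am k 0 = 0"
  by (metis am_ell_g ell_g_zero)

lemma am_ell_K: "am k (ell_K k) = pi / 2"
  by (simp add: ell_K_def)

lemma am_bounds: "a \<in> {- ell_K k<..ell_K k} \<Longrightarrow> - (pi / 2) < am k a \<and> am k a \<le> pi / 2"
  using am_less_iff[of "- ell_K k" a] am_le_iff[of a "ell_K k"] by (simp add: am_ell_K)

section \<open>Recovering the index from the oriented circle\<close>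

lemma dn_pos: "0 < dn k u"
  using delta_bounds by (simp add: dn_def sn_def)

lemma cn_nonneg: "a \<in> {- ell_K k<..ell_K k} \<Longrightarrow> 0 \<le> cn k a"
  using am_bounds[of a] by (auto simp: cn_def intro!: cos_ge_zero)

text \<open>Cosine is even and injective on \<open>{0..pi}\<close>, so it determines the absolute
  value of the amplitude; oddness of \<open>am\<close> carries the sign over to the index.\<close>

lemma cn_eq_imp:
  assumes "a \<in> {- ell_K k<..ell_K k}" "b \<in> {- ell_K k<..ell_K k}" "cn k a = cn k b"
  shows "a = b \<or> a = - b"
proof -
  have "\<bar>am k a\<bar> = \<bar>am k b\<bar>"
  proof (rule cos_inj_pi)
    show "cos \<bar>am k a\<bar> = cos \<bar>am k b\<bar>"
      using assms(3) by (simp add: cn_def)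
  qed (use am_bounds[OF assms(1)] am_bounds[OF assms(2)] pi_gt_zero in linarith)+
  then have "am k a = am k b \<or> am k a = am k (- b)"
    by (auto simp: abs_eq_iff)
  then show ?thesis
    by (metis ell_g_am)
qed

lemma inj_on_base_circle: "inj_on (base_circle k) {- ell_K k<..ell_K k}"
proof (rule inj_onI)
  fix a b
  assume a: "a \<in> {- ell_K k<..ell_K k}" and b: "b \<in> {- ell_K k<..ell_K k}"
    and eq: "base_circle k a = base_circle k b"
  have "0 \<le> 2 * cn k u / (1 + dn k u)" if "u \<in> {- ell_K k<..ell_K k}" for u
    using cn_nonneg[OF that] dn_pos[of u] by simp
  then have center: "(dn k a - 1) / (dn k a + 1) = (dn k b - 1) / (dn k b + 1)"
    and radius: "2 * cn k a / (1 + dn k a) = 2 * cn k b / (1 + dn k b)"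
    using eq a b by (auto simp: base_circle_def sphere_on_axis_eq_iff)
  \<comment> \<open>The map x to (x - 1) / (x + 1) is injective on positive x.\<close>
  have "dn k a = dn k b"
    using center dn_pos[of a] dn_pos[of b] by (simp add: frac_eq_eq algebra_simps)
  then have "cn k a = cn k b"
    using radius dn_pos[of b] by simp
  \<comment> \<open>If \<open>a = - b\<close> is nonzero, both indices avoid the endpoint
    \<open>ell_K k\<close>, because its negative is excluded; then the two orientations are
    opposite.\<close>
  from cn_eq_imp[OF a b this] show "a = b"
    using eq a b by (auto simp: base_circle_def split: if_splits)
qed

section \<open>Indices modulo 2K\<close>

lemma reduced_works: "reduced k u \<in> {- ell_K k<..ell_K k}" "[u = reduced k u] (rmod 2 * ell_K k)"
  using theI'[OF ex1_rcong_interval[OF ell_K_pos, of u]] by (simp_all only: reduced_def)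

lemma reduced_eqI: "c \<in> {- ell_K k<..ell_K k} \<Longrightarrow> [u = c] (rmod 2 * ell_K k) \<Longrightarrow> reduced k u = c"
  using ex1_rcong_interval[OF ell_K_pos, of u] reduced_works[of u] by blast

text \<open>Injectivity of \<open>base_circle\<close> on representatives makes \<open>circ k\<close>
  a faithful copy of the reals modulo 2K.\<close>

lemma circ_eq_iff: "circ k u = circ k v \<longleftrightarrow> [u = v] (rmod 2 * ell_K k)"
proof -
  have "circ k u = circ k v \<longleftrightarrow> reduced k u = reduced k v"
    unfolding circ_def using inj_on_base_circle reduced_works(1) by (metis inj_on_eq_iff)
  also have "\<dots> \<longleftrightarrow> [u = v] (rmod 2 * ell_K k)"
    using reduced_works[of u] reduced_works[of v] reduced_eqI rcong_trans rcong_sym by metis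
  finally show ?thesis .
qed

lemma circ_reduced [simp]: "circ k (reduced k u) = circ k u"
  using circ_eq_iff reduced_works(2) by metis

lemma circ_index_circ: "circ_index k (circ k u) = reduced k u"
  unfolding circ_index_def
proof (rule the_equality)
  fix a assume a: "a \<in> {- ell_K k<..ell_K k} \<and> circ k a = circ k u"
  then have "[u = a] (rmod 2 * ell_K k)"
    by (metis circ_eq_iff)
  with a show "a = reduced k u"
    by (metis reduced_eqI)
qed (use reduced_works(1) in simp)

text \<open>Reducing the summands changes the sum only by a multiple of 2K, which
  \<open>circ\<close> ignores.\<close>

lemma circ_op_circ: "circ_op k (circ k u) (circ k v) = circ k (u + v)"
proof -
  have "[reduced k u + reduced k v = u + v] (rmod 2 * ell_K k)"
    by (intro rcong_add rcong_sym[OF reduced_works(2)])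
  then show ?thesis
    by (simp add: circ_op_def circ_index_circ circ_eq_iff)
qed

section \<open>The group of circles\<close>

text \<open>With all real indices allowed, the group laws are inherited directly from real addition,
  without reducing sums or negatives.\<close>

lemma carrier_circle_group: "carrier (circle_group k) = range (circ k)"
proof -
  have "circ k u \<in> circ k ` {- ell_K k<..ell_K k}" for u
    using reduced_works(1) circ_reduced by (metis imageI)
  then show ?thesis
    by (auto simp: circle_group_def)
qed

lemma mult_circle_group: "circ k u \<otimes>\<^bsub>circle_group k\<^esub> circ k v = circ k (u + v)"
  by (simp add: circle_group_def circ_op_circ)

lemma one_circle_group: "\<one>\<^bsub>circle_group k\<^esub> = circ k 0"
  by (simp add: circle_group_def)

lemma comm_group_circle_group: "comm_group (circle_group k)"
proof (rule comm_groupI)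
  fix X assume "X \<in> carrier (circle_group k)"
  then obtain u where "X = circ k u"
    by (auto simp: carrier_circle_group)
  then have "circ k (- u) \<otimes>\<^bsub>circle_group k\<^esub> X = \<one>\<^bsub>circle_group k\<^esub>"
    by (simp add: mult_circle_group one_circle_group)
  then show "\<exists>Y\<in>carrier (circle_group k). Y \<otimes>\<^bsub>circle_group k\<^esub> X = \<one>\<^bsub>circle_group k\<^esub>"
    by (auto simp: carrier_circle_group)
qed (auto simp: carrier_circle_group mult_circle_group one_circle_group add_ac)

text \<open>This includes the point circle: index -K reduces to K, so that circle is its own
  inverse.\<close>

lemma inv_circle_group: "inv\<^bsub>circle_group k\<^esub> (circ k u) = circ k (- u)"
proof -
  interpret comm_group "circle_group k"
    by (rule comm_group_circle_group)
  show ?thesis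
    by (rule inv_equality) (auto simp: carrier_circle_group mult_circle_group one_circle_group)
qed

lemma circ_zero: "circ k 0 = unit_circle"
proof -
  have "reduced k 0 = 0"
    using ell_K_pos by (intro reduced_eqI) auto
  then show ?thesis
    by (simp add: circ_def base_circle_def unit_circle_def dn_def sn_def cn_def)
qed

end

theorem theorem2:
  fixes k :: real
  assumes "0 < k" and "k < 1"
  shows "(\<forall>a\<in>{- ell_K k<..ell_K k}. \<forall>b\<in>{- ell_K k<..ell_K k}.
            (\<exists>!c. c \<in> {- ell_K k<..ell_K k} \<and> [a + b = c] (rmod 2 * ell_K k)) \<and>
            (\<forall>c\<in>{- ell_K k<..ell_K k}. [a + b = c] (rmod 2 * ell_K k) \<longrightarrow>
               circ k a \<otimes>\<^bsub>circle_group k\<^esub> circ k b = circ k c)) \<and>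
         comm_group (circle_group k) \<and>
         carrier (circle_group k) = {circ k a | a. a \<in> {- ell_K k<..ell_K k}} \<and>
         \<one>\<^bsub>circle_group k\<^esub> = circ k 0 \<and>
         circ k 0 = unit_circle \<and>
         (\<forall>a\<in>{- ell_K k<..ell_K k}. inv\<^bsub>circle_group k\<^esub> (circ k a) = circ k (- a))"
proof -
  have modulus: "k\<^sup>2 < 1"
    using assms by (simp add: abs_square_less_1)
  \<comment> \<open>The product has index \<open>a + b\<close>; \<open>circ_eq_iff\<close> lets any
    congruent \<open>c\<close> replace it.\<close>
  note mult_circle_group[OF modulus] circ_eq_iff[OF modulus]
    comm_group_circle_group[OF modulus] one_circle_group[OF modulus]
    circ_zero[OF modulus] inv_circle_group[OF modulus]
  moreover have "carrier (circle_group k) = {circ k a | a. a \<in> {- ell_K k<..ell_K k}}"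
    by (auto simp: circle_group_def)
  moreover note ex1_rcong_interval[OF ell_K_pos[OF modulus]]
  ultimately show ?thesis
    by simp
qed

end
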